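(* Fix $\tau>0$ and let $(z^\ell)_{\ell\ge0}$ be an infinite sequence generated by the preconditioned HMLBFGS inner iteration for $\Phi_\tau$ (in any of the modes N, E, H), with all iterates in a compact subset of $\mathcal K_0$ and with the component gradients continuous on the projection of that set to $\mathbb R^n$. Let $U\subseteq\mathbb R^{n+1}$ be a convex neighborhood and suppose that $z^*\in U$ is stationary ($\nabla\Phi_\tau(z^* )=0$) and that, for every $z\in U$, $$m_\Phi I\preceq\nabla^2\Phi_\tau(z)\preceq M_\Phi I,\qquad 0<m_\Phi\le M_\Phi.$$ Assume that, from some index onward, all iterates and all trial segments remain in $U$. Then $z^*$ is the unique minimizer of $\Phi_\tau$ on $U$, and the objective values converge Q-linearly to $\Phi_\tau(z^* )$, i.e. there is $q\in(0,1)$ with $\Phi_\tau(z^{\ell+1})-\Phi_\tau(z^* )\le q\,(\Phi_\tau(z^\ell)-\Phi_\tau(z^* ))$ for all sufficiently large $\ell$; consequently, the iterates converge R-linearly to $z^*$, i.e. there are $C<\infty$ and $\rho\in(0,1)$ with $\|z^\ell-z^*\|\le C\rho^\ell$ for all sufficiently large $\ell$.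
   Context: Let $f_1,\dots,f_m:\mathbb R^n\to\mathbb R$ be differentiable, $f=\max_if_i$. For $\tau>0$ put $\phi_\tau(r)=\frac{r+\sqrt{r^2+\tau^2}}{2}$ and $\Phi_\tau(x,t)=t+\sum_{i=1}^m\phi_\tau(f_i(x)-t)$, $(x,t)\in\mathbb R^n\times\mathbb R$. For the initial smoothing parameter $\tau_0>0$ and $z_0=(x_0,f(x_0))$, $\mathcal K_0=\{z:\Phi_{\tau_0}(z)\le\Phi_{\tau_0}(z_0)\}$. Preconditioner. For $z=(x,t)$ put $q_i(x)=(\nabla f_i(x)^T,-1)^T$, $\omega_i=((f_i(x)-t)^2+\tau^2)^{1/2}$, let $J(z)\in\mathbb R^{m\times(n+1)}$ have rows $q_i(x)^T$, $\Pi_x=\begin{pmatrix}I_n&0\\0&0\end{pmatrix}$, $D^{\rm hyp}(z,\tau)=\operatorname{diag}(\omega_1^{-1},\dots,\omega_m^{-1})$, and $P(z,\tau)=\delta I_{n+1}+\bar L\Pi_x+\frac12J(z)^TD^{\rm hyp}(z,\tau)J(z)$, where $\delta>0$ and $\bar L=\sum_iL_i$ are fixed, $L_i\ge0$ being a Lipschitz constant of $\nabla f_i$ on a set containing the accepted iterates and every line-search trial segment. Limited-memory metric. Fixed parameters: $m_L\ge1$, $0<m_{\rm cur}<M_{\rm cur}$, $\chi_0>0$, $0<\chi_{\min}\le\chi_{\max}$. For an ordered memory $\mathcal M=\{(s_j,\widetilde y_j,\rho_j)\}_{j=1}^q$, $q\le m_L$, $\rho_j=(s_j^T\widetilde y_j)^{-1}$,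 and $P\succ0$, set $H^{(0)}=\chi P^{-1}$ with $\chi=\chi_0$ if $q=0$ and $\chi=\min\{\chi_{\max},\max\{\chi_{\min},s_q^T\widetilde y_q/(\widetilde y_q^TP^{-1}\widetilde y_q)\}\}$ if $q>0$; $H^{(j)}=(I-\rho_js_j\widetilde y_j^T)H^{(j-1)}(I-\rho_j\widetilde y_js_j^T)+\rho_js_js_j^T$; $H_{\mathcal M,P}=H^{(q)}$ and $B_{\mathcal M,P}=H_{\mathcal M,P}^{-1}$. Inner iteration for fixed $\tau$ (mode N, E or H). Start with $\mathcal M=\varnothing$. At iterate $z=z^\ell$ with $g=\nabla\Phi_\tau(z)\ne0$: let $P=P(z,\tau)$ and $d=-H_{\mathcal M,P}g$; if $g^Td\ge0$ (or on a restart), clear $\mathcal M$ and take the restart direction $d=-g$. Starting from a fixed initial trial step, backtrack by a factor $\beta\in(0,1)$ (without a cap on the number of trials) until the Armijo condition $\Phi_\tau(z+\lambda d)\le\Phi_\tau(z)+\alpha\lambda g^Td$ holds, $0<\alpha<1$; the trial segments are the segments from $z$ to the tested points $z+\lambda d$. Set $z^{\ell+1}=z+\lambda d$, $s=z^{\ell+1}-z$, $y=\nabla\Phi_\tau(z^{\ell+1})-g$, $c=s^Ty$, $\eta=\max\{m_{\rm cur}\|s\|^2,\|y\|^2/M_{\rm cur}\}$. Pair processing: if $c>\eta$, store $\widetilde y=y$; in mode N, if $c<-\eta$, store $\widetilde y=-y$; in mode E, if $c<-\eta$, store $\widetilde y=y-2c\,s/(s^Ts)$; in mode H, if $c<-m_{\rm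 cur}\|s\|^2$, put $b=B_{\mathcal M,P}s$, $\widetilde y=y-2c\,b/(s^Tb)$ and store it if $\|\widetilde y\|^2<M_{\rm cur}|c|$; otherwise discard the pair (a pair may also be discarded by an optional numerical tolerance treating $c$ as zero). When storing $(s,\widetilde y,(s^T\widetilde y)^{-1})$, append it to $\mathcal M$, deleting the oldest pair if more than $m_L$ are present. Consequently every stored pair satisfies $s^T\widetilde y/\|s\|^2>m_{\rm cur}$ and $\|\widetilde y\|^2/(s^T\widetilde y)<M_{\rm cur}$. *)

theory Defs
  imports "HOL-Analysis.Analysis"
begin

text \<open>
  The space of the variables \<open>z = (x, t)\<close> is the product type \<open>(real^'n) \<times> real\<close>, whose library norm is
  the Euclidean one.  Square matrices of order \<open>n + 1\<close> are represented by the operators on this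
  space that they induce: matrix products are compositions, transposes are adjoints, and the inverse
  matrix is the inverse function.
\<close>

section \<open>Gradient, Hessian and Loewner order\<close>

definition grad :: "('a::real_inner \<Rightarrow> real) \<Rightarrow> 'a \<Rightarrow> 'a" where
  "grad F x = (THE D. GDERIV F x :> D)"

definition hess :: "('a::real_inner \<Rightarrow> real) \<Rightarrow> 'a \<Rightarrow> 'a \<Rightarrow> 'a" where
  "hess F x = frechet_derivative (grad F) (at x)"

text \<open>\<open>B - A\<close> is symmetric and positive semidefinite.\<close>

definition loewner_le :: "('a::real_inner \<Rightarrow> 'a) \<Rightarrow> ('a \<Rightarrow> 'a) \<Rightarrow> bool" where
  "loewner_le A B \<longleftrightarrow>
     (\<forall>u v. (B u - A u) \<bullet> v = u \<bullet> (B v - A v)) \<and> (\<forall>v. 0 \<le> v \<bullet> (B v - A v))"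

section \<open>The smoothed maximum\<close>

definition fmax :: "('m::finite \<Rightarrow> 'a \<Rightarrow> real) \<Rightarrow> 'a \<Rightarrow> real" where
  "fmax f x = Max (range (\<lambda>i. f i x))"

definition phi :: "real \<Rightarrow> real \<Rightarrow> real" where
  "phi \<tau> r = (r + sqrt (r\<^sup>2 + \<tau>\<^sup>2)) / 2"

definition Phi :: "('m::finite \<Rightarrow> 'a \<Rightarrow> real) \<Rightarrow> real \<Rightarrow> 'a \<times> real \<Rightarrow> real" where
  "Phi f \<tau> = (\<lambda>(x, t). t + (\<Sum>i\<in>UNIV. phi \<tau> (f i x - t)))"

definition K0 :: "('m::finite \<Rightarrow> 'a \<Rightarrow> real) \<Rightarrow> real \<Rightarrow> 'a \<Rightarrow> ('a \<times> real) set" where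
  "K0 f \<tau>0 x0 = {z. Phi f \<tau>0 z \<le> Phi f \<tau>0 (x0, fmax f x0)}"

section \<open>The preconditioner\<close>

definition qvec :: "('m::finite \<Rightarrow> real^'n \<Rightarrow> real) \<Rightarrow> 'm \<Rightarrow> real^'n \<Rightarrow> (real^'n) \<times> real" where
  "qvec f i x = (grad (f i) x, -1)"

definition omega :: "('m::finite \<Rightarrow> real^'n \<Rightarrow> real) \<Rightarrow> real \<Rightarrow> (real^'n) \<times> real \<Rightarrow> 'm \<Rightarrow> real" where
  "omega f \<tau> z i = sqrt ((f i (fst z) - snd z)\<^sup>2 + \<tau>\<^sup>2)"

definition Jop :: "('m::finite \<Rightarrow> real^'n \<Rightarrow> real) \<Rightarrow> (real^'n) \<times> real \<Rightarrow> (real^'n) \<times> real \<Rightarrow> real^'m" where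
  "Jop f z h = (\<chi> i. qvec f i (fst z) \<bullet> h)"

definition Pi_x :: "(real^'n) \<times> real \<Rightarrow> (real^'n) \<times> real" where
  "Pi_x h = (fst h, 0)"

definition Dhyp :: "('m::finite \<Rightarrow> real^'n \<Rightarrow> real) \<Rightarrow> real \<Rightarrow> (real^'n) \<times> real \<Rightarrow> real^'m \<Rightarrow> real^'m" where
  "Dhyp f \<tau> z w = (\<chi> i. inverse (omega f \<tau> z i) * w $ i)"

definition precond ::
  "('m::finite \<Rightarrow> real^'n \<Rightarrow> real) \<Rightarrow> ('m \<Rightarrow> real) \<Rightarrow> real \<Rightarrow> real \<Rightarrow> (real^'n) \<times> real
     \<Rightarrow> (real^'n) \<times> real \<Rightarrow> (real^'n) \<times> real" where
  "precond f L \<delta> \<tau> z h =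
     \<delta> *\<^sub>R h + (\<Sum>i\<in>UNIV. L i) *\<^sub>R Pi_x h
       + (1/2) *\<^sub>R adjoint (Jop f z) (Dhyp f \<tau> z (Jop f z h))"

section \<open>The limited-memory metric\<close>

record hmlbfgs_params =
  delta :: real
  m_L :: nat
  m_cur :: real
  M_cur :: real
  chi0 :: real
  chi_min :: real
  chi_max :: real
  armijo_alpha :: real
  back_beta :: real
  step0 :: real

definition valid_params :: "hmlbfgs_params \<Rightarrow> bool" where
  "valid_params p \<longleftrightarrow>
     0 < delta p \<and> 1 \<le> m_L p \<and> 0 < m_cur p \<and> m_cur p < M_cur p \<and>
     0 < chi0 p \<and> 0 < chi_min p \<and> chi_min p \<le> chi_max p \<and>
     0 < armijo_alpha p \<and> armijo_alpha p < 1 \<and>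
     0 < back_beta p \<and> back_beta p < 1 \<and> 0 < step0 p"

text \<open>Triples \<open>(s, ytilde, \<rho>)\<close>, oldest first.\<close>

type_synonym 'z memory = "('z \<times> 'z \<times> real) list"

text \<open>The rank-one matrix \<open>a b\<^sup>T\<close>.\<close>

definition outer :: "'z::real_inner \<Rightarrow> 'z \<Rightarrow> 'z \<Rightarrow> 'z" where
  "outer a b v = (b \<bullet> v) *\<^sub>R a"

definition bfgs_update :: "'z::real_inner \<times> 'z \<times> real \<Rightarrow> ('z \<Rightarrow> 'z) \<Rightarrow> 'z \<Rightarrow> 'z" where
  "bfgs_update = (\<lambda>(s, y, \<rho>) H v.
     ((\<lambda>u. u - \<rho> *\<^sub>R outer s y u) \<circ> H \<circ> (\<lambda>u. u - \<rho> *\<^sub>R outer y s u)) v + \<rho> *\<^sub>R outer s s v)"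

definition chi_scale :: "hmlbfgs_params \<Rightarrow> 'z::real_inner memory \<Rightarrow> ('z \<Rightarrow> 'z) \<Rightarrow> real" where
  "chi_scale p M P =
     (if M = [] then chi0 p
      else let (s, y, \<rho>) = last M
           in min (chi_max p) (max (chi_min p) ((s \<bullet> y) / (y \<bullet> inv P y))))"

definition Hmat :: "hmlbfgs_params \<Rightarrow> 'z::real_inner memory \<Rightarrow> ('z \<Rightarrow> 'z) \<Rightarrow> 'z \<Rightarrow> 'z" where
  "Hmat p M P = fold bfgs_update M (\<lambda>v. chi_scale p M P *\<^sub>R inv P v)"

definition Bmat :: "hmlbfgs_params \<Rightarrow> 'z::real_inner memory \<Rightarrow> ('z \<Rightarrow> 'z) \<Rightarrow> 'z \<Rightarrow> 'z" where
  "Bmat p M P = inv (Hmat p M P)"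

section \<open>Pair processing\<close>

datatype mode = Mode_N | Mode_E | Mode_H

definition eta :: "hmlbfgs_params \<Rightarrow> 'z::real_inner \<Rightarrow> 'z \<Rightarrow> real" where
  "eta p s y = max (m_cur p * (norm s)\<^sup>2) ((norm y)\<^sup>2 / M_cur p)"

text \<open>The vector to be stored together with \<open>s\<close>, or \<open>None\<close> if the pair is discarded.\<close>

definition processed ::
  "hmlbfgs_params \<Rightarrow> mode \<Rightarrow> ('z \<Rightarrow> 'z) \<Rightarrow> 'z::real_inner \<Rightarrow> 'z \<Rightarrow> 'z option" where
  "processed p md B s y =
     (let c = s \<bullet> y in
      if c > eta p s y then Some y
      else case md of
        Mode_N \<Rightarrow> if c < - eta p s y then Some (- y) else None
      | Mode_E \<Rightarrow> if c < - eta p s y then Some (y - (2 * c / (s \<bullet> s)) *\<^sub>R s) else None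
      | Mode_H \<Rightarrow>
          if c < - (m_cur p * (norm s)\<^sup>2)
          then let b = B s; yt = y - (2 * c / (s \<bullet> b)) *\<^sub>R b
               in if (norm yt)\<^sup>2 < M_cur p * \<bar>c\<bar> then Some yt else None
          else None)"

definition store :: "hmlbfgs_params \<Rightarrow> 'z::real_inner memory \<Rightarrow> 'z \<Rightarrow> 'z \<Rightarrow> 'z memory" where
  "store p M s yt =
     (let M' = M @ [(s, yt, inverse (s \<bullet> yt))]
      in if length M' > m_L p then tl M' else M')"

text \<open>
  \<open>ctol\<close> is the optional tolerance below which \<open>c = s \<bullet> y\<close> is treated as zero; a negative value
  disables it.
\<close>

definition next_memory ::
  "hmlbfgs_params \<Rightarrow> mode \<Rightarrow> real \<Rightarrow> 'z::real_inner memory \<Rightarrow> ('z \<Rightarrow> 'z) \<Rightarrow> 'z \<Rightarrow> 'z \<Rightarrow> 'z memory" where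
  "next_memory p md ctol M P s y =
     (if \<bar>s \<bullet> y\<bar> \<le> ctol then M
      else case processed p md (Bmat p M P) s y of None \<Rightarrow> M | Some yt \<Rightarrow> store p M s yt)"

section \<open>Backtracking line search\<close>

definition trial_step :: "hmlbfgs_params \<Rightarrow> nat \<Rightarrow> real" where
  "trial_step p j = step0 p * back_beta p ^ j"

definition armijo ::
  "hmlbfgs_params \<Rightarrow> ('z::real_inner \<Rightarrow> real) \<Rightarrow> 'z \<Rightarrow> 'z \<Rightarrow> real \<Rightarrow> bool" where
  "armijo p F z d lam \<longleftrightarrow> F (z + lam *\<^sub>R d) \<le> F z + armijo_alpha p * lam * (grad F z \<bullet> d)"

definition backtracking ::
  "hmlbfgs_params \<Rightarrow> ('z::real_inner \<Rightarrow> real) \<Rightarrow> 'z \<Rightarrow> 'z \<Rightarrow> nat \<Rightarrow> bool" where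
  "backtracking p F z d k \<longleftrightarrow>
     armijo p F z d (trial_step p k) \<and> (\<forall>j<k. \<not> armijo p F z d (trial_step p j))"

text \<open>The union of the trial segments when the \<open>k\<close>-th reduction is the accepted one.\<close>

definition trial_segments :: "hmlbfgs_params \<Rightarrow> 'z::real_inner \<Rightarrow> 'z \<Rightarrow> nat \<Rightarrow> 'z set" where
  "trial_segments p z d k = (\<Union>j\<le>k. closed_segment z (z + trial_step p j *\<^sub>R d))"

section \<open>The inner iteration\<close>

text \<open>
  \<open>mem l\<close> is the memory at the start of iteration \<open>l\<close>, \<open>d l\<close> the search direction actually used,
  and \<open>k l\<close> the number of step reductions.  The flags \<open>restart l\<close> model restarts that are triggered
  for reasons other than \<open>g \<bullet> d \<ge> 0\<close>.
\<close>

definition hmlbfgs_run ::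
  "('m::finite \<Rightarrow> real^'n \<Rightarrow> real) \<Rightarrow> ('m \<Rightarrow> real) \<Rightarrow> hmlbfgs_params \<Rightarrow> mode \<Rightarrow> real
     \<Rightarrow> (nat \<Rightarrow> bool) \<Rightarrow> (nat \<Rightarrow> real)
     \<Rightarrow> (nat \<Rightarrow> (real^'n) \<times> real) \<Rightarrow> (nat \<Rightarrow> ((real^'n) \<times> real) memory)
     \<Rightarrow> (nat \<Rightarrow> (real^'n) \<times> real) \<Rightarrow> (nat \<Rightarrow> nat) \<Rightarrow> bool" where
  "hmlbfgs_run f L p md \<tau> restart ctol z mem d k \<longleftrightarrow>
     mem 0 = [] \<and>
     (\<forall>l. let g = grad (Phi f \<tau>) (z l);
              P = precond f L (delta p) \<tau> (z l);
              dq = - Hmat p (mem l) P g;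
              rs = (restart l \<or> g \<bullet> dq \<ge> 0);
              M = (if rs then [] else mem l);
              s = z (Suc l) - z l;
              y = grad (Phi f \<tau>) (z (Suc l)) - g
          in g \<noteq> 0 \<and>
             d l = (if rs then - g else dq) \<and>
             backtracking p (Phi f \<tau>) (z l) (d l) (k l) \<and>
             z (Suc l) = z l + trial_step p (k l) *\<^sub>R d l \<and>
             mem (Suc l) = next_memory p md (ctol l) M P s y)"

end

theory Submission
  imports Defs
begin

text \<open>
  Every update with a pair of controlled curvature changes the spectral bounds of the metric in a
  controlled way, and at most \<open>m_L\<close> updates are applied to a multiple of an inverse preconditioner
  that is itself uniformly bounded on the compact set of iterates.  Hence the search directions are
  uniformly gradient related, the accepted steps are bounded below, and the Armijo decrease is at
  least a fixed multiple of the squared gradient norm, which under strong convexity dominates the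
  objective gap.
\<close>

section \<open>Second-order bounds on a convex set\<close>

text \<open>Convexity is available only on \<open>U\<close>, whereas the memory may still hold pairs
  formed before the iterates entered \<open>U\<close>. The metric is therefore controlled from index
  0 on, by the safeguard inequalities of the stored pairs and by compactness;
  \<open>m\<^sub>\<Phi>\<close> and \<open>M\<^sub>\<Phi>\<close> enter only through quadratic
  models between points of \<open>U\<close>. A lower bound on the quadratic form is paired with an
  upper bound on the operator norm, since this combination passes through inversion, scaling and
  updating by itself. The memory invariant and positivity of the metric are intertwined: in mode H
  the next pair is built with the inverse metric, whose positivity presupposes that the present
  pairs are sound. The rate arises from a decrease of \<kappa> times the squared gradient norm and
  the Polyak-Lojasiewicz inequality, which contract the gap by
  \<open>1 - 2 * m\<^sub>\<Phi> * \<kappa>\<close>; quadratic growth at \<open>zstar\<close> then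
  costs a square root in the rate of the iterates.\<close>

lemma GDERIV_grad:
  fixes F :: "'a::euclidean_space \<Rightarrow> real"
  assumes "F differentiable (at w)"
  shows "GDERIV F w :> grad F w"
proof -
  obtain A where A: "(F has_derivative A) (at w)"
    using assms by (auto simp: differentiable_def)
  have lin: "linear A" using A has_derivative_linear by blast
  \<comment> \<open>The vector \<open>adjoint A 1\<close> is the Riesz representative of the
    functional \<open>A\<close>; its uniqueness, shown next, makes the definite description in
    \<open>grad\<close> denote it.\<close>
  have "A h = h \<bullet> adjoint A 1" for h
    using adjoint_works[OF lin, of h 1] by simp
  then have "A = (\<lambda>h. h \<bullet> adjoint A 1)" by blast
  with A have G: "GDERIV F w :> adjoint A 1" by (simp add: gderiv_def)
  have "D = adjoint A 1" if "GDERIV F w :> D" for D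
  proof -
    have "(\<lambda>h. h \<bullet> D) = (\<lambda>h. h \<bullet> adjoint A 1)"
      using that G unfolding gderiv_def by (rule has_derivative_unique)
    then have "h \<bullet> D = h \<bullet> adjoint A 1" for h by meson
    then show ?thesis by (metis vector_eq_ldot)
  qed
  with G have "grad F w = adjoint A 1" unfolding grad_def by blast
  with G show ?thesis by simp
qed

text \<open>Along the segment, \<open>F\<close> minus its linear part and the quadratic term has
  nonnegative second derivative and vanishing first derivative at 0, hence is nondecreasing on
  [0,1]. Applying monotonicity twice, instead of a Taylor formula, uses nothing but the pointwise
  existence of \<open>H\<close>.\<close>

lemma quadratic_lower_bound:
  fixes F :: "'a::real_inner \<Rightarrow> real"
  assumes U: "convex U" "a \<in> U" "b \<in> U"
    and F: "\<And>w. w \<in> U \<Longrightarrow> GDERIV F w :> G w"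
    and G: "\<And>w. w \<in> U \<Longrightarrow> (G has_derivative H w) (at w)"
    and H: "\<And>w v. w \<in> U \<Longrightarrow> m * (v \<bullet> v) \<le> v \<bullet> H w v"
  shows "F a + G a \<bullet> (b - a) + m / 2 * (norm (b - a))\<^sup>2 \<le> F b"
proof -
  define v where "v = b - a"
  define c where "c = (\<lambda>t::real. a + t *\<^sub>R v)"
  have cU: "c t \<in> U" if "0 \<le> t" "t \<le> 1" for t
  proof -
    have "c t = (1 - t) *\<^sub>R a + t *\<^sub>R b" by (simp add: c_def v_def algebra_simps)
    then show ?thesis using U that by (simp add: convexD_alt)
  qed
  have dc: "(c has_derivative (\<lambda>h. h *\<^sub>R v)) (at t)" for t
    unfolding c_def by (auto intro!: derivative_eq_intros)
  define \<psi>' where "\<psi>' = (\<lambda>t. G (c t) \<bullet> v - G a \<bullet> v - m * t * (v \<bullet> v))"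
  define \<psi> where "\<psi> = (\<lambda>t. F (c t) - t * (G a \<bullet> v) - m / 2 * t\<^sup>2 * (v \<bullet> v))"
  have d1: "DERIV \<psi> t :> \<psi>' t" if t: "0 \<le> t" "t \<le> 1" for t
  proof -
    have "((\<lambda>t. F (c t)) has_derivative (\<lambda>h. (h *\<^sub>R v) \<bullet> G (c t))) (at t)"
      using has_derivative_compose[OF dc F[OF cU[OF t], unfolded gderiv_def]] .
    then have "DERIV (\<lambda>t. F (c t)) t :> G (c t) \<bullet> v"
      by (simp add: has_field_derivative_def inner_commute mult_commute_abs)
    then show ?thesis
      unfolding \<psi>_def \<psi>'_def by (auto intro!: derivative_eq_intros)
  qed
  have d2: "DERIV \<psi>' t :> H (c t) v \<bullet> v - m * (v \<bullet> v)" if t: "0 \<le> t" "t \<le> 1" for t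
  proof -
    have lin: "linear (H (c t))" using G[OF cU[OF t]] has_derivative_linear by blast
    have "((\<lambda>t. G (c t)) has_derivative (\<lambda>h. H (c t) (h *\<^sub>R v))) (at t)"
      using has_derivative_compose[OF dc G[OF cU[OF t]]] .
    then have "((\<lambda>t. G (c t) \<bullet> v) has_derivative (\<lambda>h. H (c t) (h *\<^sub>R v) \<bullet> v)) (at t)"
      by (rule has_derivative_inner_left)
    then have "DERIV (\<lambda>t. G (c t) \<bullet> v) t :> H (c t) v \<bullet> v"
      by (simp add: has_field_derivative_def linear_scale[OF lin] mult_commute_abs)
    then show ?thesis
      unfolding \<psi>'_def by (auto intro!: derivative_eq_intros)
  qed
  have "\<psi>' 0 \<le> \<psi>' t" if t: "0 \<le> t" "t \<le> 1" for t
  proof (rule DERIV_nonneg_imp_nondecreasing[OF t(1)])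
    fix x assume "0 \<le> x" "x \<le> t"
    then have x: "0 \<le> x" "x \<le> 1" using t by auto
    then show "\<exists>y. DERIV \<psi>' x :> y \<and> 0 \<le> y"
      using d2[OF x] H[OF cU[OF x], of v] by (auto simp: inner_commute)
  qed
  then have pos: "0 \<le> \<psi>' t" if "0 \<le> t" "t \<le> 1" for t
    using that by (simp add: \<psi>'_def c_def)
  have "\<psi> 0 \<le> \<psi> 1"
    by (rule DERIV_nonneg_imp_nondecreasing) (use d1 pos in auto)
  then show ?thesis
    by (simp add: \<psi>_def c_def v_def power2_norm_eq_inner)
qed

text \<open>This is the lower bound for \<open>- F\<close> with constant \<open>- M\<close>, whose
  sign is unrestricted there.\<close>

lemma quadratic_upper_bound:
  fixes F :: "'a::real_inner \<Rightarrow> real"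
  assumes U: "convex U" "a \<in> U" "b \<in> U"
    and F: "\<And>w. w \<in> U \<Longrightarrow> GDERIV F w :> G w"
    and G: "\<And>w. w \<in> U \<Longrightarrow> (G has_derivative H w) (at w)"
    and H: "\<And>w v. w \<in> U \<Longrightarrow> v \<bullet> H w v \<le> M * (v \<bullet> v)"
  shows "F b \<le> F a + G a \<bullet> (b - a) + M / 2 * (norm (b - a))\<^sup>2"
proof -
  have "- F a + (- G a) \<bullet> (b - a) + (- M) / 2 * (norm (b - a))\<^sup>2 \<le> - F b"
  proof (rule quadratic_lower_bound[OF U, of "\<lambda>w. - F w" "\<lambda>w. - G w" "\<lambda>w v. - H w v"])
    show "GDERIV (\<lambda>w. - F w) w :> - G w" if "w \<in> U" for w
      using F[OF that] by (rule GDERIV_minus)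
    show "((\<lambda>w. - G w) has_derivative (\<lambda>v. - H w v)) (at w)" if "w \<in> U" for w
      using G[OF that] by (rule has_derivative_minus)
    show "- M * (v \<bullet> v) \<le> v \<bullet> (- H w v)" if "w \<in> U" for w v
      using H[OF that, of v] by simp
  qed
  then show ?thesis by simp
qed

section \<open>Bounds on the metric\<close>

text \<open>For symmetric \<open>H\<close> this implies that the spectrum lies in [a,b]. The
  two-sided form is chosen so that closure under inversion and updates can be proved by elementary
  norm estimates.\<close>

definition spectral_bounds :: "real \<Rightarrow> real \<Rightarrow> ('a::real_inner \<Rightarrow> 'a) \<Rightarrow> bool" where
  "spectral_bounds a b H \<longleftrightarrow>
     linear H \<and> (\<forall>v. a * (norm v)\<^sup>2 \<le> v \<bullet> H v) \<and> (\<forall>v. norm (H v) \<le> b * norm v)"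

lemma spectral_boundsD:
  assumes "spectral_bounds a b H"
  shows "linear H" "a * (norm v)\<^sup>2 \<le> v \<bullet> H v" "norm (H v) \<le> b * norm v"
  using assms by (auto simp: spectral_bounds_def)

lemma spectral_bounds_mono:
  assumes "spectral_bounds a b H" "a' \<le> a" "b \<le> b'"
  shows "spectral_bounds a' b' H"
  unfolding spectral_bounds_def
proof (intro conjI allI)
  show "linear H" using assms by (auto simp: spectral_bounds_def)
  show "a' * (norm v)\<^sup>2 \<le> v \<bullet> H v" for v
    using spectral_boundsD(2)[OF assms(1), of v] mult_right_mono[OF assms(2), of "(norm v)\<^sup>2"]
    by simp
  show "norm (H v) \<le> b' * norm v" for v
    using spectral_boundsD(3)[OF assms(1), of v] mult_right_mono[OF assms(3), of "norm v"]
    by simp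
qed

lemma spectral_bounds_bij:
  fixes H :: "'a::euclidean_space \<Rightarrow> 'a"
  assumes "spectral_bounds a b H" "0 < a"
  shows "bij H"
proof -
  have lin: "linear H" using assms spectral_boundsD by blast
  have "v = 0" if "H v = 0" for v
    using spectral_boundsD(2)[OF assms(1), of v] that assms(2)
    by (simp add: mult_le_0_iff)
  then have "inj H" using lin by (simp add: linear_injective_0)
  then show ?thesis
    using lin by (simp add: bij_def linear_injective_imp_surjective)
qed

text \<open>With \<open>w = inv H s\<close> the quantity becomes \<open>w \<bullet> H w\<close>. It
  provides the nonzero denominator \<open>s \<bullet> B s\<close> of mode H.\<close>

lemma inner_inv_pos:
  fixes H :: "'a::euclidean_space \<Rightarrow> 'a"
  assumes "spectral_bounds a b H" "0 < a" "s \<noteq> 0"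
  shows "0 < s \<bullet> inv H s"
proof -
  have eq: "H (inv H s) = s"
    using spectral_bounds_bij[OF assms(1,2)] by (simp add: bij_is_surj surj_f_inv_f)
  have "inv H s \<noteq> 0"
    using eq assms(3) spectral_boundsD(1)[OF assms(1)] linear_0 by metis
  then have "0 < a * (norm (inv H s))\<^sup>2" using assms(2) by simp
  also have "\<dots> \<le> inv H s \<bullet> H (inv H s)" by (rule spectral_boundsD[OF assms(1)])
  finally show ?thesis by (simp add: eq inner_commute)
qed

text \<open>With \<open>w = inv P v\<close>, coercivity gives \<open>v \<bullet> w\<close> at least
  a |w|^2, and the norm bound gives |v| at most b |w|. Combining the two produces a / b^2, in place
  of the value 1 / b of the symmetric case.\<close>

lemma spectral_bounds_inv:
  fixes P :: "'a::euclidean_space \<Rightarrow> 'a"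
  assumes P: "spectral_bounds a b P" and "0 < a" "0 < b"
  shows "spectral_bounds (a / b\<^sup>2) (1 / a) (inv P)"
  unfolding spectral_bounds_def
proof (intro conjI allI)
  have bij: "bij P" using spectral_bounds_bij[OF P \<open>0 < a\<close>] .
  have eq: "P (inv P v) = v" for v using bij by (simp add: bij_is_surj surj_f_inv_f)
  have linP: "linear P" using P spectral_boundsD by blast
  show "linear (inv P)"
    using linP bij by (metis bij_is_inj inj_linear_imp_inv_linear)
  fix v
  let ?w = "inv P v"
  have low: "a * (norm ?w)\<^sup>2 \<le> v \<bullet> ?w"
    using spectral_boundsD(2)[OF P, of ?w] by (simp add: eq inner_commute)
  also have "\<dots> \<le> norm v * norm ?w" by (rule norm_cauchy_schwarz)
  finally have "a * norm ?w \<le> norm v"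
    by (cases "norm ?w = 0") (auto simp: power2_eq_square mult_ac)
  then show "norm ?w \<le> 1 / a * norm v" using \<open>0 < a\<close> by (simp add: field_simps)
  have "norm v \<le> b * norm ?w" using spectral_boundsD(3)[OF P, of ?w] by (simp add: eq)
  then have "(norm v)\<^sup>2 \<le> (b * norm ?w)\<^sup>2" by (rule power_mono) simp
  then have "a / b\<^sup>2 * (norm v)\<^sup>2 \<le> a / b\<^sup>2 * (b * norm ?w)\<^sup>2"
    using \<open>0 < a\<close> by (intro mult_left_mono) auto
  also have "\<dots> = a * (norm ?w)\<^sup>2" using \<open>0 < b\<close> by (simp add: power_mult_distrib)
  also note low
  finally show "a / b\<^sup>2 * (norm v)\<^sup>2 \<le> v \<bullet> ?w" .
qed

lemma spectral_bounds_scale: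
  fixes H :: "'a::real_inner \<Rightarrow> 'a"
  assumes "spectral_bounds a b H" "0 \<le> a" "0 \<le> b" "0 \<le> c1" "c1 \<le> c" "c \<le> c2"
  shows "spectral_bounds (c1 * a) (c2 * b) (\<lambda>v. c *\<^sub>R H v)"
  unfolding spectral_bounds_def
proof (intro conjI allI)
  show "linear (\<lambda>v. c *\<^sub>R H v)"
    using spectral_boundsD(1)[OF assms(1)] by (rule linear_compose_scale_right)
  fix v :: 'a
  have "(c1 * a) * (norm v)\<^sup>2 \<le> c * (a * (norm v)\<^sup>2)"
    using assms by (simp add: mult_right_mono mult.assoc)
  also have "\<dots> \<le> c * (v \<bullet> H v)"
    using assms spectral_boundsD(2)[OF assms(1)] by (intro mult_left_mono) auto
  finally show "c1 * a * (norm v)\<^sup>2 \<le> v \<bullet> c *\<^sub>R H v" by simp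
  have "\<bar>c\<bar> * norm (H v) \<le> c2 * (b * norm v)"
    using assms spectral_boundsD(3)[OF assms(1)] by (intro mult_mono) auto
  then show "norm (c *\<^sub>R H v) \<le> c2 * b * norm v" by (simp add: mult.assoc)
qed

text \<open>The storage conditions in non-strict form. Positivity is listed separately because the
  two inequalities alone would admit the zero pair.\<close>

definition curvature_pair :: "real \<Rightarrow> real \<Rightarrow> 'a::real_inner \<times> 'a \<times> real \<Rightarrow> bool" where
  "curvature_pair m M = (\<lambda>(s, y, \<rho>).
     \<rho> = inverse (s \<bullet> y) \<and> 0 < s \<bullet> y \<and> m * (norm s)\<^sup>2 \<le> s \<bullet> y \<and> (norm y)\<^sup>2 \<le> M * (s \<bullet> y))"

text \<open>The update is W H V + \<rho> s s^T with W the transpose of V. The upper bound follows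
  from the norm bound 1 + sqrt (M / m) on both factors. For the lower bound, a direction that V
  nearly annihilates is close to a multiple of \<open>y\<close>, and there the rank-one term
  compensates.\<close>

lemma spectral_bounds_bfgs_update:
  fixes H :: "'a::real_inner \<Rightarrow> 'a"
  assumes H: "spectral_bounds a b H" and "0 < a" "0 < b"
    and pair: "curvature_pair m M x" and "0 < m" "0 < M"
  shows "spectral_bounds (min (a / 2) (1 / (2 * M))) ((1 + sqrt (M / m))\<^sup>2 * b + 1 / m)
           (bfgs_update x H)"
proof -
  obtain s y \<rho> where x: "x = (s, y, \<rho>)" by (cases x)
  define c where "c = s \<bullet> y"
  have c: "0 < c" "\<rho> = 1 / c" "m * (norm s)\<^sup>2 \<le> c" "(norm y)\<^sup>2 \<le> M * c"
    using pair by (auto simp: curvature_pair_def x c_def inverse_eq_divide)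
  have \<rho>: "0 < \<rho>" using c by simp
  define V where "V = (\<lambda>u. u - (\<rho> * (s \<bullet> u)) *\<^sub>R y)"
  define W where "W = (\<lambda>u. u - (\<rho> * (y \<bullet> u)) *\<^sub>R s)"
  have linH: "linear H" using H spectral_boundsD by blast
  have upd: "bfgs_update x H = (\<lambda>v. W (H (V v)) + (\<rho> * (s \<bullet> v)) *\<^sub>R s)"
    by (auto simp: bfgs_update_def x outer_def V_def W_def fun_eq_iff)
  have "linear V" "linear W"
    unfolding V_def W_def by (auto intro!: linearI simp: algebra_simps inner_simps)
  have "linear (\<lambda>v. W (H (V v)))"
    using linear_compose[OF linear_compose[OF \<open>linear V\<close> linH] \<open>linear W\<close>] by (simp add: o_def)
  moreover have "linear (\<lambda>v. (\<rho> * (s \<bullet> v)) *\<^sub>R s)"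
    by (auto intro!: linearI simp: algebra_simps inner_simps)
  ultimately have lin: "linear (bfgs_update x H)"
    unfolding upd by (rule linear_compose_add)
  have \<rho>s: "\<rho> * (norm s)\<^sup>2 \<le> 1 / m" and \<rho>y: "\<rho> * (norm y)\<^sup>2 \<le> M"
    unfolding c(2) using c(1,3,4) \<open>0 < m\<close> by (auto simp: field_simps)
  \<comment> \<open>The product of the bounds on \<rho> |s|^2 and \<rho> |y|^2 controls the mixed
    term, which is the operator norm of the rank-one part of V and W.\<close>
  have "(\<rho> * (norm s * norm y))\<^sup>2 = (\<rho> * (norm s)\<^sup>2) * (\<rho> * (norm y)\<^sup>2)"
    by (simp add: power2_eq_square mult_ac)
  also have "\<dots> \<le> 1 / m * M"
    using \<rho>s \<rho>y \<rho> \<open>0 < m\<close> by (intro mult_mono) auto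
  finally have sy: "\<rho> * (norm s * norm y) \<le> sqrt (M / m)"
    by (intro real_le_rsqrt) simp
  have normV: "norm (V u) \<le> (1 + sqrt (M / m)) * norm u" for u
  proof -
    have "norm (V u) \<le> norm u + \<rho> * \<bar>s \<bullet> u\<bar> * norm y"
      unfolding V_def using norm_triangle_ineq4[of u "(\<rho> * (s \<bullet> u)) *\<^sub>R y"] \<rho>
      by (simp add: abs_mult)
    also have "\<rho> * \<bar>s \<bullet> u\<bar> * norm y \<le> \<rho> * (norm s * norm u) * norm y"
      using \<rho> Cauchy_Schwarz_ineq2[of s u] by (intro mult_right_mono mult_left_mono) auto
    also have "\<dots> = \<rho> * (norm s * norm y) * norm u" by simp
    also have "\<dots> \<le> sqrt (M / m) * norm u" using sy by (rule mult_right_mono) simp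
    finally show ?thesis by (simp add: algebra_simps)
  qed
  have normW: "norm (W u) \<le> (1 + sqrt (M / m)) * norm u" for u
  proof -
    have "norm (W u) \<le> norm u + \<rho> * \<bar>y \<bullet> u\<bar> * norm s"
      unfolding W_def using norm_triangle_ineq4[of u "(\<rho> * (y \<bullet> u)) *\<^sub>R s"] \<rho>
      by (simp add: abs_mult)
    also have "\<rho> * \<bar>y \<bullet> u\<bar> * norm s \<le> \<rho> * (norm y * norm u) * norm s"
      using \<rho> Cauchy_Schwarz_ineq2[of y u] by (intro mult_right_mono mult_left_mono) auto
    also have "\<dots> = \<rho> * (norm s * norm y) * norm u" by simp
    also have "\<dots> \<le> sqrt (M / m) * norm u" using sy by (rule mult_right_mono) simp
    finally show ?thesis by (simp add: algebra_simps)
  qed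
  let ?K = "1 + sqrt (M / m)"
  have K: "0 \<le> ?K" using \<open>0 < m\<close> \<open>0 < M\<close> by simp
  have upper: "norm (bfgs_update x H v) \<le> (?K\<^sup>2 * b + 1 / m) * norm v" for v
  proof -
    have "norm (W (H (V v))) \<le> ?K * norm (H (V v))" by (rule normW)
    also have "\<dots> \<le> ?K * (b * norm (V v))"
      using K spectral_boundsD(3)[OF H] by (intro mult_left_mono)
    also have "\<dots> \<le> ?K * (b * (?K * norm v))"
      using K normV \<open>0 < b\<close> by (intro mult_left_mono) auto
    finally have 1: "norm (W (H (V v))) \<le> ?K\<^sup>2 * b * norm v"
      by (simp add: power2_eq_square mult_ac)
    have "norm ((\<rho> * (s \<bullet> v)) *\<^sub>R s) = \<rho> * \<bar>s \<bullet> v\<bar> * norm s"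
      using \<rho> by (simp add: abs_mult)
    also have "\<dots> \<le> \<rho> * (norm s * norm v) * norm s"
      using \<rho> Cauchy_Schwarz_ineq2[of s v] by (intro mult_right_mono mult_left_mono) auto
    also have "\<dots> = \<rho> * (norm s)\<^sup>2 * norm v" by (simp add: power2_eq_square)
    also have "\<dots> \<le> 1 / m * norm v" using \<rho>s by (rule mult_right_mono) simp
    finally have 2: "norm ((\<rho> * (s \<bullet> v)) *\<^sub>R s) \<le> 1 / m * norm v" .
    show ?thesis
      unfolding upd using norm_triangle_ineq[of "W (H (V v))" "(\<rho> * (s \<bullet> v)) *\<^sub>R s"] 1 2
      by (simp only: distrib_right)
  qed
  have lower: "min (a / 2) (1 / (2 * M)) * (norm v)\<^sup>2 \<le> v \<bullet> bfgs_update x H v" for v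
  proof -
    let ?A = "min (a / 2) (1 / (2 * M))" and ?e = "\<rho> * (s \<bullet> v)\<^sup>2"
    have e: "0 \<le> ?e" using \<rho> by simp
    have A: "0 \<le> ?A" using \<open>0 < a\<close> \<open>0 < M\<close> by simp
    have adj: "v \<bullet> W u = V v \<bullet> u" for u
      by (simp add: V_def W_def inner_simps inner_commute)
    have eq: "v \<bullet> bfgs_update x H v = V v \<bullet> H (V v) + ?e"
      unfolding upd by (simp add: inner_simps adj power2_eq_square inner_commute)
    \<comment> \<open>The first summand is paid for by the coercivity of \<open>H\<close>, the
      second by the rank-one energy \<open>?e\<close>, because its squared norm is at most
      \<open>M * ?e\<close>.\<close>
    have "v = V v + (\<rho> * (s \<bullet> v)) *\<^sub>R y" by (simp add: V_def)
    then have "norm v \<le> norm (V v) + norm ((\<rho> * (s \<bullet> v)) *\<^sub>R y)"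
      by (metis norm_triangle_ineq)
    then have "(norm v)\<^sup>2 \<le> (norm (V v) + norm ((\<rho> * (s \<bullet> v)) *\<^sub>R y))\<^sup>2"
      by (rule power_mono) simp
    also have "\<dots> \<le> 2 * (norm (V v))\<^sup>2 + 2 * (norm ((\<rho> * (s \<bullet> v)) *\<^sub>R y))\<^sup>2"
      using sum_squares_bound[of "norm (V v)" "norm ((\<rho> * (s \<bullet> v)) *\<^sub>R y)"]
      unfolding power2_sum by linarith
    also have "(norm ((\<rho> * (s \<bullet> v)) *\<^sub>R y))\<^sup>2 = ?e * (\<rho> * (norm y)\<^sup>2)"
      by (simp add: power_mult_distrib power2_eq_square)
    also have "\<dots> \<le> ?e * M" using \<rho>y e by (rule mult_left_mono)
    finally have n: "(norm v)\<^sup>2 \<le> 2 * (norm (V v))\<^sup>2 + 2 * (?e * M)" by simp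
    have "?A * (norm v)\<^sup>2 \<le> ?A * (2 * (norm (V v))\<^sup>2 + 2 * (?e * M))"
      using n A by (rule mult_left_mono)
    also have "\<dots> = (2 * ?A) * (norm (V v))\<^sup>2 + (2 * M * ?A) * ?e"
      by (simp add: algebra_simps)
    \<comment> \<open>The two entries of the minimum \<open>?A\<close> absorb the factor 2 from
      squaring the triangle inequality, one for each summand.\<close>
    also have "\<dots> \<le> a * (norm (V v))\<^sup>2 + 1 * ?e"
    proof (intro add_mono mult_right_mono e)
      show "2 * ?A \<le> a" by simp
      have "2 * M * ?A \<le> 2 * M * (1 / (2 * M))" using \<open>0 < M\<close> by (intro mult_left_mono) auto
      then show "2 * M * ?A \<le> 1" using \<open>0 < M\<close> by simp
    qed simp
    also have "\<dots> \<le> v \<bullet> bfgs_update x H v"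
      unfolding eq using spectral_boundsD(2)[OF H, of "V v"] by simp
    finally show ?thesis .
  qed
  show ?thesis using lin lower upper by (simp add: spectral_bounds_def)
qed

text \<open>The constants precede the quantifiers over the memory and \<open>H\<close>, so they
  depend on the length bound alone. The induction generalises \<open>a\<close> and \<open>b\<close>,
  since the oldest pair acts first and replaces them by worse constants.\<close>

lemma spectral_bounds_fold_bfgs_update:
  assumes "0 < m" "0 < M" "0 < a" "0 < b"
  shows "\<exists>a' b'. 0 < a' \<and> 0 < b' \<and>
    (\<forall>mem (H :: 'a::real_inner \<Rightarrow> 'a). length mem \<le> n \<longrightarrow> (\<forall>x\<in>set mem. curvature_pair m M x) \<longrightarrow>
       spectral_bounds a b H \<longrightarrow> spectral_bounds a' b' (fold bfgs_update mem H))"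
  using assms(3,4)
proof (induction n arbitrary: a b)
  case 0
  then show ?case by auto
next
  case (Suc n)
  define a1 where "a1 = min (a / 2) (1 / (2 * M))"
  define b1 where "b1 = (1 + sqrt (M / m))\<^sup>2 * b + 1 / m"
  have "0 < a1" using Suc.prems assms by (simp add: a1_def)
  moreover have "0 < b1"
    unfolding b1_def using Suc.prems assms by (intro add_nonneg_pos) auto
  ultimately obtain a' b' where a': "0 < a'" "0 < b'" and step:
    "\<And>mem (H :: 'a \<Rightarrow> 'a). length mem \<le> n \<Longrightarrow> \<forall>x\<in>set mem. curvature_pair m M x \<Longrightarrow>
       spectral_bounds a1 b1 H \<Longrightarrow> spectral_bounds a' b' (fold bfgs_update mem H)"
    using Suc.IH[of a1 b1] by blast
  \<comment> \<open>An empty memory leaves the original constants, a nonempty one yields those of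
    the induction hypothesis; \<open>min\<close> and \<open>max\<close> cover both.\<close>
  have "spectral_bounds (min a a') (max b b') (fold bfgs_update mem H)"
    if "length mem \<le> Suc n" "\<forall>x\<in>set mem. curvature_pair m M x" "spectral_bounds a b H"
    for mem and H :: "'a \<Rightarrow> 'a"
  proof (cases mem)
    case Nil
    then show ?thesis using that by (auto intro: spectral_bounds_mono)
  next
    case (Cons x xs)
    have "spectral_bounds a1 b1 (bfgs_update x H)"
      unfolding a1_def b1_def
      using that Cons Suc.prems assms by (intro spectral_bounds_bfgs_update) auto
    then have "spectral_bounds a' b' (fold bfgs_update mem H)"
      using that Cons step[of xs] by simp
    then show ?thesis by (auto intro: spectral_bounds_mono)
  qed
  moreover have "0 < min a a'" "0 < max b b'" using a' Suc.prems by auto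
  ultimately show ?case by blast
qed

text \<open>The clamping confines the scale whatever the curvature quotient is, so that quotient
  never has to be estimated.\<close>

lemma chi_scale_bounds:
  assumes "valid_params p"
  shows "min (chi0 p) (chi_min p) \<le> chi_scale p mem P" "chi_scale p mem P \<le> max (chi0 p) (chi_max p)"
  using assms by (auto simp: chi_scale_def valid_params_def Let_def split: prod.splits)

lemma spectral_bounds_Hmat:
  assumes p: "valid_params p" and "0 < a" "0 < b"
  shows "\<exists>a' b'. 0 < a' \<and> 0 < b' \<and>
    (\<forall>mem (P :: 'a::euclidean_space \<Rightarrow> 'a). length mem \<le> m_L p \<longrightarrow>
       (\<forall>x\<in>set mem. curvature_pair (m_cur p) (M_cur p) x) \<longrightarrow>
       spectral_bounds a b P \<longrightarrow> spectral_bounds a' b' (Hmat p mem P))"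
proof -
  let ?c1 = "min (chi0 p) (chi_min p)" and ?c2 = "max (chi0 p) (chi_max p)"
  have c: "0 < ?c1" "0 < ?c2" and m: "0 < m_cur p" "0 < M_cur p"
    using p by (auto simp: valid_params_def)
  have a0: "0 < ?c1 * (a / b\<^sup>2)" "0 < ?c2 * (1 / a)"
    using c assms(2,3) by (intro mult_pos_pos divide_pos_pos; simp)+
  obtain a' b' where a': "0 < a'" "0 < b'" and step:
    "\<And>mem (H :: 'a \<Rightarrow> 'a). length mem \<le> m_L p \<Longrightarrow>
       \<forall>x\<in>set mem. curvature_pair (m_cur p) (M_cur p) x \<Longrightarrow>
       spectral_bounds (?c1 * (a / b\<^sup>2)) (?c2 * (1 / a)) H \<Longrightarrow>
       spectral_bounds a' b' (fold bfgs_update mem H)"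
    using spectral_bounds_fold_bfgs_update[OF m a0, of "m_L p", where ?'a = 'a] by blast
  have "spectral_bounds a' b' (Hmat p mem P)"
    if "length mem \<le> m_L p" "\<forall>x\<in>set mem. curvature_pair (m_cur p) (M_cur p) x"
      "spectral_bounds a b P" for mem and P :: "'a \<Rightarrow> 'a"
    unfolding Hmat_def using that assms c chi_scale_bounds[OF p]
    by (intro step spectral_bounds_scale spectral_bounds_inv) auto
  with a' show ?thesis by blast
qed

section \<open>The memory invariant\<close>

text \<open>Every correction flips the sign of \<open>s \<bullet> y\<close>. Negation and the
  Euclidean reflection also preserve the norm of \<open>y\<close>; the oblique reflection of mode H
  need not, hence its explicit norm test.\<close>

lemma curvature_pair_processed:
  assumes p: "valid_params p" and B: "\<And>v. v \<noteq> 0 \<Longrightarrow> 0 < v \<bullet> B v"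
    and yt: "processed p md B s y = Some yt"
  shows "curvature_pair (m_cur p) (M_cur p) (s, yt, inverse (s \<bullet> yt))"
proof -
  have mM: "0 < m_cur p" "0 < M_cur p" using p by (auto simp: valid_params_def)
  have eta0: "0 \<le> eta p s y" using mM by (simp add: eta_def le_max_iff_disj)
  \<comment> \<open>\<open>eta\<close> depends on \<open>y\<close> only through its norm, so one
    argument serves the unchanged, the negated and the reflected vector.\<close>
  have large: "curvature_pair (m_cur p) (M_cur p) (s, w, inverse (s \<bullet> w))"
    if "eta p s y < s \<bullet> w" "norm w = norm y" for w
  proof -
    have "0 < s \<bullet> w" using that eta0 by simp
    then show ?thesis using that mM by (auto simp: curvature_pair_def eta_def field_simps)
  qed
  show ?thesis
  proof (cases "s \<bullet> y > eta p s y")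
    case True
    then show ?thesis using yt large by (auto simp: processed_def Let_def)
  next
    case False
    show ?thesis
    proof (cases md)
      case Mode_N
      then show ?thesis using yt False large[of "- y"]
        by (auto simp: processed_def Let_def split: if_splits)
    next
      case Mode_E
      define c where "c = s \<bullet> y"
      have c: "c < - eta p s y" and yt': "yt = y - (2 * c / (s \<bullet> s)) *\<^sub>R s"
        using yt False Mode_E by (auto simp: processed_def Let_def c_def split: if_splits)
      have "s \<noteq> 0" using c eta0 by (auto simp: c_def)
      then have ss: "s \<bullet> s \<noteq> 0" by simp
      have "s \<bullet> yt = - c" using ss by (simp add: yt' inner_simps c_def)
      moreover have n: "(norm yt)\<^sup>2 = (norm y)\<^sup>2"
        unfolding power2_norm_eq_inner yt' using ss
        by (simp add: inner_simps inner_commute[of y s] c_def[symmetric])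
      ultimately show ?thesis using c by (intro large power2_eq_imp_eq[OF n]) auto
    next
      case Mode_H
      define c where "c = s \<bullet> y"
      have c: "c < - (m_cur p * (norm s)\<^sup>2)" and yt': "yt = y - (2 * c / (s \<bullet> B s)) *\<^sub>R B s"
        and n: "(norm yt)\<^sup>2 < M_cur p * \<bar>c\<bar>"
        using yt False Mode_H by (auto simp: processed_def Let_def c_def split: if_splits)
      have "s \<noteq> 0" using c by (auto simp: c_def)
      then have "s \<bullet> B s \<noteq> 0" using B[of s] by simp
      then have "s \<bullet> yt = - c" by (simp add: yt' inner_simps c_def)
      moreover have "c < 0"
        using c mM by (meson less_le_trans neg_le_0_iff_le less_imp_le mult_nonneg_nonneg zero_le_power2)
      ultimately show ?thesis using c n by (auto simp: curvature_pair_def)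
    qed
  qed
qed

text \<open>The old invariant bounds \<open>Hmat\<close>, which makes \<open>Bmat\<close> positive,
  which in turn validates the pair appended now.\<close>

lemma next_memory_invariant:
  fixes P :: "'a::euclidean_space \<Rightarrow> 'a"
  assumes p: "valid_params p" and P: "spectral_bounds a b P" "0 < a" "0 < b"
    and mem: "length mem \<le> m_L p" "\<forall>x\<in>set mem. curvature_pair (m_cur p) (M_cur p) x"
  shows "length (next_memory p md ct mem P s y) \<le> m_L p \<and>
    (\<forall>x\<in>set (next_memory p md ct mem P s y). curvature_pair (m_cur p) (M_cur p) x)"
proof -
  obtain a' b' where "0 < a'" "spectral_bounds a' b' (Hmat p mem P)"
    using spectral_bounds_Hmat[OF p P(2,3)] mem P(1) by blast
  then have B: "0 < v \<bullet> Bmat p mem P v" if "v \<noteq> 0" for v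
    using that unfolding Bmat_def by (intro inner_inv_pos)
  show ?thesis
  proof (cases "processed p md (Bmat p mem P) s y")
    case None
    then show ?thesis using mem by (simp add: next_memory_def)
  next
    case (Some yt)
    have "curvature_pair (m_cur p) (M_cur p) (s, yt, inverse (s \<bullet> yt))"
      using p B Some by (rule curvature_pair_processed)
    moreover have "set (store p mem s yt) \<subseteq> insert (s, yt, inverse (s \<bullet> yt)) (set mem)"
      by (cases mem) (auto simp: store_def Let_def)
    moreover have "length (store p mem s yt) \<le> m_L p"
      using mem(1) by (auto simp: store_def Let_def)
    ultimately show ?thesis
      using mem Some by (auto simp: next_memory_def)
  qed
qed

section \<open>The preconditioner on the iterates\<close>

text \<open>Passing to the bilinear form eliminates the adjoint of \<open>Jop\<close>; linearity and
  both bounds are then read off by testing against vectors.\<close>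

lemma inner_precond:
  "u \<bullet> precond f L \<delta> \<tau> z h =
     \<delta> * (u \<bullet> h) + sum L UNIV * (fst u \<bullet> fst h)
       + (\<Sum>i\<in>UNIV. (qvec f i (fst z) \<bullet> u) * (qvec f i (fst z) \<bullet> h) / omega f \<tau> z i) / 2"
proof -
  have lin: "linear (Jop f z)"
    by (rule linearI) (auto simp: Jop_def vec_eq_iff inner_simps)
  have "Jop f z u \<bullet> Dhyp f \<tau> z (Jop f z h) =
     (\<Sum>i\<in>UNIV. (qvec f i (fst z) \<bullet> u) * (qvec f i (fst z) \<bullet> h) / omega f \<tau> z i)"
    by (simp add: Jop_def Dhyp_def inner_vec_def divide_inverse mult_ac)
  moreover have "u \<bullet> Pi_x h = fst u \<bullet> fst h"
    by (simp add: Pi_x_def inner_prod_def)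
  ultimately show ?thesis
    unfolding precond_def inner_add_right inner_scaleR_right adjoint_works[OF lin] by simp
qed

lemma linear_precond:
  fixes f :: "'m::finite \<Rightarrow> real^'n \<Rightarrow> real"
  shows "linear (precond f L \<delta> \<tau> z)"
proof (rule linearI)
  fix u v :: "(real^'n) \<times> real" and c :: real
  have "w \<bullet> precond f L \<delta> \<tau> z (u + v) = w \<bullet> (precond f L \<delta> \<tau> z u + precond f L \<delta> \<tau> z v)" for w
    unfolding inner_add_right inner_precond fst_add
    by (simp add: distrib_left add_divide_distrib sum.distrib)
  then show "precond f L \<delta> \<tau> z (u + v) = precond f L \<delta> \<tau> z u + precond f L \<delta> \<tau> z v"
    by (metis vector_eq_ldot)
  have "w \<bullet> precond f L \<delta> \<tau> z (c *\<^sub>R u) = w \<bullet> (c *\<^sub>R precond f L \<delta> \<tau> z u)" for w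
    unfolding inner_scaleR_right inner_precond fst_scaleR
    by (simp add: distrib_left sum_distrib_left mult.left_commute)
  then show "precond f L \<delta> \<tau> z (c *\<^sub>R u) = c *\<^sub>R precond f L \<delta> \<tau> z u"
    by (metis vector_eq_ldot)
qed

text \<open>The \<delta> term alone gives coercivity, the others being positive semidefinite. For
  the upper bound, each \<open>omega\<close> is at least \<tau>.\<close>

lemma spectral_bounds_precond:
  assumes "0 < \<delta>" "0 < \<tau>" "\<And>i. 0 \<le> L i" "\<And>i. norm (qvec f i (fst z)) \<le> Q"
  shows "spectral_bounds \<delta> (\<delta> + sum L UNIV + (\<Sum>i\<in>(UNIV::'m::finite set). Q\<^sup>2 / \<tau>) / 2)
           (precond (f :: 'm \<Rightarrow> real^'n \<Rightarrow> real) L \<delta> \<tau> z)"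
  unfolding spectral_bounds_def
proof (intro conjI allI)
  let ?P = "precond f L \<delta> \<tau> z"
  let ?\<Lambda> = "\<delta> + sum L UNIV + (\<Sum>i\<in>(UNIV::'m set). Q\<^sup>2 / \<tau>) / 2"
  have omega: "\<tau> \<le> omega f \<tau> z i" for i
    unfolding omega_def using assms(2) by (intro real_le_rsqrt) simp
  have L: "0 \<le> sum L UNIV" using assms(3) by (simp add: sum_nonneg)
  show "linear ?P" by (rule linear_precond)
  fix v
  show "\<delta> * (norm v)\<^sup>2 \<le> v \<bullet> ?P v"
  proof -
    have "0 \<le> (\<Sum>i\<in>UNIV. (qvec f i (fst z) \<bullet> v) * (qvec f i (fst z) \<bullet> v) / omega f \<tau> z i)"
      using omega assms(2) by (intro sum_nonneg divide_nonneg_nonneg) (auto intro: order_trans[OF less_imp_le])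
    then show ?thesis using L by (simp add: inner_precond power2_norm_eq_inner)
  qed
  have bil: "u \<bullet> ?P v \<le> ?\<Lambda> * (norm u * norm v)" for u
  proof -
    have fst_le: "norm (fst w) \<le> norm w" for w :: "(real^'n) \<times> real"
      by (cases w) (simp add: norm_fst_le)
    have "fst u \<bullet> fst v \<le> norm (fst u) * norm (fst v)" by (rule norm_cauchy_schwarz)
    also have "\<dots> \<le> norm u * norm v" using fst_le by (intro mult_mono) auto
    finally have 1: "fst u \<bullet> fst v \<le> norm u * norm v" .
    have 2: "(qvec f i (fst z) \<bullet> u) * (qvec f i (fst z) \<bullet> v) / omega f \<tau> z i
        \<le> Q\<^sup>2 / \<tau> * (norm u * norm v)" for i
    proof -
      let ?q = "qvec f i (fst z)"
      have Q: "\<bar>?q \<bullet> w\<bar> \<le> Q * norm w" for w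
        using Cauchy_Schwarz_ineq2[of ?q w] mult_right_mono[OF assms(4)[of i], of "norm w"] by simp
      have "(?q \<bullet> u) * (?q \<bullet> v) \<le> \<bar>?q \<bullet> u\<bar> * \<bar>?q \<bullet> v\<bar>"
        by (metis abs_ge_self abs_mult)
      also have "\<dots> \<le> (Q * norm u) * (Q * norm v)"
        using Q order_trans[OF abs_ge_zero Q] by (intro mult_mono) auto
      finally have "(?q \<bullet> u) * (?q \<bullet> v) \<le> Q\<^sup>2 * (norm u * norm v)"
        by (simp add: power2_eq_square mult_ac)
      then have "(?q \<bullet> u) * (?q \<bullet> v) / omega f \<tau> z i \<le> Q\<^sup>2 * (norm u * norm v) / \<tau>"
        using omega[of i] assms(2) by (intro frac_le) auto
      then show ?thesis by simp
    qed
    have "u \<bullet> ?P v \<le> \<delta> * (norm u * norm v) + sum L UNIV * (norm u * norm v)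
        + (\<Sum>i\<in>(UNIV::'m set). Q\<^sup>2 / \<tau> * (norm u * norm v)) / 2"
      unfolding inner_precond using 1 2 L assms(1)
      by (intro add_mono mult_left_mono divide_right_mono sum_mono norm_cauchy_schwarz) auto
    then show ?thesis by (simp add: algebra_simps)
  qed
  \<comment> \<open>Testing the bilinear bound with \<open>u = ?P v\<close> and cancelling one
    factor turns it into an operator norm bound.\<close>
  have "norm (?P v) * norm (?P v) \<le> norm (?P v) * (?\<Lambda> * norm v)"
    using bil[of "?P v"] by (simp only: dot_square_norm power2_eq_square mult_ac)
  moreover have "0 \<le> ?\<Lambda> * norm v"
    using L assms(1,2) by (intro mult_nonneg_nonneg add_nonneg_nonneg) auto
  ultimately show "norm (?P v) \<le> ?\<Lambda> * norm v"
    using mult_le_cancel_left_pos[of "norm (?P v)" "norm (?P v)" "?\<Lambda> * norm v"]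
    by (cases "?P v = 0") (simp_all only: norm_zero zero_less_norm_iff, blast)
qed

lemma norm_qvec_bounded:
  fixes C :: "((real^'n) \<times> real) set"
  assumes "compact C" "\<And>i. continuous_on (fst ` C) (grad (f i))"
  shows "\<exists>Q. \<forall>z\<in>C. \<forall>i::'m::finite. norm (qvec f i (fst z)) \<le> Q"
proof -
  have "compact (fst ` C)" using assms(1) by (intro compact_continuous_image continuous_intros)
  then have "bounded (grad (f i) ` fst ` C)" for i
    using assms(2) compact_continuous_image compact_imp_bounded by blast
  then have "\<forall>i. \<exists>b. \<forall>z\<in>C. norm (grad (f i) (fst z)) \<le> b"
    by (auto simp: bounded_iff)
  then obtain b where b: "\<And>i z. z \<in> C \<Longrightarrow> norm (grad (f i) (fst z)) \<le> b i" by metis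
  have "norm (qvec f i (fst z)) \<le> Max (range b) + 1" if "z \<in> C" for z i
  proof -
    have "norm (qvec f i (fst z)) \<le> norm (grad (f i) (fst z)) + norm (-1::real)"
      unfolding qvec_def by (rule norm_Pair_le)
    also have "\<dots> \<le> b i + 1" using b[OF that] by simp
    also have "b i \<le> Max (range b)" by simp
    finally show ?thesis by simp
  qed
  then show ?thesis by blast
qed

section \<open>Gradient-related directions and the decrease of the objective\<close>

lemma differentiable_Phi:
  assumes "\<And>i x. f i differentiable (at x)" "0 < \<tau>"
  shows "Phi f \<tau> differentiable (at w)"
proof -
  \<comment> \<open>Smoothing by \<tau> > 0 keeps the argument of the square root away from 0, where
    it is not differentiable.\<close>
  have pos: "0 < r\<^sup>2 + \<tau>\<^sup>2" for r :: real
    using assms(2) by (simp add: add_nonneg_pos)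
  have "\<exists>D. DERIV (phi \<tau>) r :> D" for r
    unfolding phi_def using pos[of r] by (auto intro!: exI derivative_eq_intros)
  then have phi: "phi \<tau> differentiable (at r)" for r
    by (auto simp: real_differentiable_def)
  have fst: "(\<lambda>w. f i (fst w)) differentiable (at w)" for i and w :: "'b \<times> real"
    using differentiable_chain_at[of fst w "f i"] assms(1)
    by (simp add: o_def bounded_linear_fst bounded_linear_imp_differentiable)
  have snd: "(snd :: 'b \<times> real \<Rightarrow> real) differentiable (at w)"
    by (simp add: bounded_linear_snd bounded_linear_imp_differentiable)
  have "(\<lambda>w. phi \<tau> (f i (fst w) - snd w)) differentiable (at w)" for i
    using differentiable_chain_at[of "\<lambda>w. f i (fst w) - snd w" w "phi \<tau>"] fst snd phi
    by (simp add: o_def)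
  then have "(\<lambda>w. snd w + (\<Sum>i\<in>UNIV. phi \<tau> (f i (fst w) - snd w))) differentiable (at w)"
    using snd by simp
  moreover have "Phi f \<tau> = (\<lambda>w. snd w + (\<Sum>i\<in>UNIV. phi \<tau> (f i (fst w) - snd w)))"
    by (auto simp: Phi_def)
  ultimately show ?thesis by simp
qed

lemma hmlbfgs_run_directions:
  fixes f :: "'m::finite \<Rightarrow> real^'n \<Rightarrow> real"
  assumes p: "valid_params p" and "0 < \<tau>" "\<And>i. 0 \<le> L i"
    and run: "hmlbfgs_run f L p md \<tau> restart ctol z mem d k"
    and C: "compact C" "\<And>l. z l \<in> C" "\<And>i. continuous_on (fst ` C) (grad (f i))"
  shows "\<exists>c1 c2. 0 < c1 \<and> 0 < c2 \<and>
    (\<forall>l. grad (Phi f \<tau>) (z l) \<bullet> d l \<le> - c1 * (norm (grad (Phi f \<tau>) (z l)))\<^sup>2 \<and>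
         norm (d l) \<le> c2 * norm (grad (Phi f \<tau>) (z l)))"
proof -
  define g where "g l = grad (Phi f \<tau>) (z l)" for l
  define P where "P l = precond f L (delta p) \<tau> (z l)" for l
  define rs where "rs l \<longleftrightarrow> restart l \<or> g l \<bullet> (- Hmat p (mem l) (P l) (g l)) \<ge> 0" for l
  have run': "mem 0 = []" "d l = (if rs l then - g l else - Hmat p (mem l) (P l) (g l))"
    "mem (Suc l) = next_memory p md (ctol l) (if rs l then [] else mem l) (P l)
       (z (Suc l) - z l) (g (Suc l) - g l)" for l
    using run by (auto simp: hmlbfgs_run_def Let_def g_def P_def rs_def)
  have \<delta>: "0 < delta p" using p by (simp add: valid_params_def)
  obtain Q where "\<And>l i. norm (qvec f i (fst (z l))) \<le> Q"
    using norm_qvec_bounded[OF C(1), of f] C(2,3) by blast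
  then obtain b where P: "\<And>l. spectral_bounds (delta p) b (P l)"
    unfolding P_def using spectral_bounds_precond[OF \<delta> assms(2), of L f _ Q] assms(3) by blast
  \<comment> \<open>Enlarging the upper constant to at least 1 makes it positive, as the metric
    bounds require.\<close>
  have P: "spectral_bounds (delta p) (max b 1) (P l)" for l
    using spectral_bounds_mono[OF P] by simp
  have b: "0 < max b 1" by simp
  have inv: "length (mem l) \<le> m_L p \<and> (\<forall>x\<in>set (mem l). curvature_pair (m_cur p) (M_cur p) x)" for l
  proof (induction l)
    case 0
    then show ?case by (simp add: run')
  next
    case (Suc l)
    show ?case
      unfolding run'(3) using Suc by (intro next_memory_invariant[OF p P \<delta> b]) auto
  qed
  obtain a' b' where a': "0 < a'" "0 < b'" and H: "\<And>l. spectral_bounds a' b' (Hmat p (mem l) (P l))"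
    using spectral_bounds_Hmat[OF p \<delta> b] inv P by metis
  have "g l \<bullet> d l \<le> - min 1 a' * (norm (g l))\<^sup>2 \<and> norm (d l) \<le> max 1 b' * norm (g l)" for l
  proof -
    have "spectral_bounds 1 1 (\<lambda>v::(real^'n) \<times> real. v)"
      by (simp add: spectral_bounds_def power2_norm_eq_inner linearI)
    then have id: "spectral_bounds (min 1 a') (max 1 b') (\<lambda>v::(real^'n) \<times> real. v)"
      by (rule spectral_bounds_mono) auto
    have H': "spectral_bounds (min 1 a') (max 1 b') (Hmat p (mem l) (P l))"
      using H by (rule spectral_bounds_mono) auto
    \<comment> \<open>A restart amounts to using the identity as metric, so both kinds of direction
      are treated with common constants.\<close>
    have "\<exists>A. spectral_bounds (min 1 a') (max 1 b') A \<and> d l = - A (g l)"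
    proof (cases "rs l")
      case True
      then show ?thesis using id run'(2) by (intro exI[of _ "\<lambda>v. v"]) simp
    next
      case False
      then show ?thesis using H' run'(2) by (intro exI[of _ "Hmat p (mem l) (P l)"]) simp
    qed
    then obtain A where "spectral_bounds (min 1 a') (max 1 b') A" "d l = - A (g l)" by blast
    then show ?thesis using spectral_boundsD(2,3)[of "min 1 a'" "max 1 b'" A "g l"] by simp
  qed
  moreover have "0 < min 1 a'" "0 < max 1 b'" using a' by auto
  ultimately show ?thesis unfolding g_def by blast
qed

text \<open>If a reduction took place, the previous trial violated Armijo; against the quadratic
  upper model this forces that trial to be at least \<open>?t\<close>, so the accepted step is at
  least \<open>back_beta p * ?t\<close>. Otherwise the step is \<open>step0 p\<close>.\<close>

lemma backtracking_decrease:
  fixes F :: "'a::real_inner \<Rightarrow> real"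
  assumes p: "valid_params p" and "0 < M" "0 < c1" "0 < c2"
    and upper: "\<And>w. w \<in> U \<Longrightarrow> F w \<le> F z + grad F z \<bullet> (w - z) + M / 2 * (norm (w - z))\<^sup>2"
    and bt: "backtracking p F z d k" and seg: "trial_segments p z d k \<subseteq> U"
    and g: "grad F z \<noteq> 0"
    and desc: "grad F z \<bullet> d \<le> - c1 * (norm (grad F z))\<^sup>2" and d: "norm d \<le> c2 * norm (grad F z)"
  shows "F (z + trial_step p k *\<^sub>R d) \<le> F z -
    armijo_alpha p * min (step0 p) (back_beta p * (2 * (1 - armijo_alpha p) * c1 / (M * c2\<^sup>2))) *
    c1 * (norm (grad F z))\<^sup>2"
proof -
  let ?\<alpha> = "armijo_alpha p" and ?g = "grad F z"
  let ?t = "2 * (1 - ?\<alpha>) * c1 / (M * c2\<^sup>2)"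
  let ?lam = "min (step0 p) (back_beta p * ?t)"
  have par: "0 < ?\<alpha>" "?\<alpha> < 1" "0 < back_beta p" "0 < step0 p"
    using p by (auto simp: valid_params_def)
  have step: "?lam \<le> trial_step p k"
  proof (cases k)
    case 0
    then show ?thesis by (simp add: trial_step_def)
  next
    case (Suc j)
    let ?s = "trial_step p j"
    have s: "0 < ?s" using par by (simp add: trial_step_def)
    \<comment> \<open>The rejected point is not an iterate; the upper model applies to it because
      the whole trial segments lie in \<open>U\<close>.\<close>
    have "z + ?s *\<^sub>R d \<in> trial_segments p z d k"
      unfolding trial_segments_def using Suc by (auto intro!: bexI[of _ j])
    then have "z + ?s *\<^sub>R d \<in> U" using seg by blast
    from upper[OF this]
    have "F (z + ?s *\<^sub>R d) \<le> F z + ?s * (?g \<bullet> d) + M / 2 * (?s\<^sup>2 * (norm d)\<^sup>2)"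
      by (simp add: power_mult_distrib)
    moreover have "F z + ?\<alpha> * ?s * (?g \<bullet> d) < F (z + ?s *\<^sub>R d)"
      using bt Suc by (auto simp: backtracking_def armijo_def)
    ultimately have "?s * ((1 - ?\<alpha>) * - (?g \<bullet> d)) < ?s * (M / 2 * ?s * (norm d)\<^sup>2)"
      by (simp add: power2_eq_square algebra_simps)
    then have "(1 - ?\<alpha>) * - (?g \<bullet> d) \<le> M / 2 * ?s * (norm d)\<^sup>2"
      using s by (simp only: mult_less_cancel_left_pos less_imp_le)
    moreover have "(1 - ?\<alpha>) * (c1 * (norm ?g)\<^sup>2) \<le> (1 - ?\<alpha>) * - (?g \<bullet> d)"
      using desc par by (intro mult_left_mono) auto
    moreover have "M / 2 * ?s * (norm d)\<^sup>2 \<le> M / 2 * ?s * (c2 * norm ?g)\<^sup>2"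
      using s assms(2) d by (intro mult_left_mono power_mono) auto
    ultimately have "((1 - ?\<alpha>) * c1) * (norm ?g)\<^sup>2 \<le> (M / 2 * ?s * c2\<^sup>2) * (norm ?g)\<^sup>2"
      by (simp add: power_mult_distrib mult_ac)
    then have "(1 - ?\<alpha>) * c1 \<le> M / 2 * ?s * c2\<^sup>2"
      using g mult_le_cancel_right_pos[of "(norm ?g)\<^sup>2"] by simp
    then have "?t \<le> ?s" using assms(2,4) by (simp add: field_simps)
    then have "back_beta p * ?t \<le> back_beta p * ?s" using par by (intro mult_left_mono) auto
    also have "\<dots> = trial_step p k" by (simp add: Suc trial_step_def)
    finally show ?thesis by simp
  qed
  have "0 \<le> ?lam" using par assms(2,3) by simp
  have "F (z + trial_step p k *\<^sub>R d) \<le> F z + ?\<alpha> * trial_step p k * (?g \<bullet> d)"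
    using bt by (simp add: backtracking_def armijo_def)
  also have "\<dots> \<le> F z + ?\<alpha> * trial_step p k * (- c1 * (norm ?g)\<^sup>2)"
    using desc par by (intro add_left_mono mult_left_mono) (auto simp: trial_step_def)
  also have "\<dots> = F z - ?\<alpha> * trial_step p k * (c1 * (norm ?g)\<^sup>2)" by simp
  also have "\<dots> \<le> F z - ?\<alpha> * ?lam * (c1 * (norm ?g)\<^sup>2)"
    using step par assms(3) by (intro diff_left_mono mult_right_mono mult_left_mono) auto
  finally show ?thesis by (simp only: mult.assoc)
qed

theorem theorem9p2:
  fixes f :: "'m::finite \<Rightarrow> real^'n \<Rightarrow> real"
    and L :: "'m \<Rightarrow> real"
    and S :: "(real^'n) set"
    and p :: hmlbfgs_params
    and md :: mode
    and \<tau> \<tau>0 m\<^sub>\<Phi> M\<^sub>\<Phi> :: real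
    and x0 :: "real^'n"
    and restart :: "nat \<Rightarrow> bool"
    and ctol :: "nat \<Rightarrow> real"
    and z d :: "nat \<Rightarrow> (real^'n) \<times> real"
    and mem :: "nat \<Rightarrow> ((real^'n) \<times> real) memory"
    and k :: "nat \<Rightarrow> nat"
    and C U :: "((real^'n) \<times> real) set"
    and zstar :: "(real^'n) \<times> real"
  assumes f_diff: "\<And>i x. f i differentiable (at x)"
    and params: "valid_params p"
    and tau: "0 < \<tau>" and tau0: "0 < \<tau>0"
    and run: "hmlbfgs_run f L p md \<tau> restart ctol z mem d k"
    and lip: "\<And>i. (L i)-lipschitz_on S (grad (f i))"
    and lip_set: "\<And>l. fst (z l) \<in> S" "\<And>l. fst ` trial_segments p (z l) (d l) (k l) \<subseteq> S"
    and C: "compact C" "C \<subseteq> K0 f \<tau>0 x0" "\<And>l. z l \<in> C"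
    and grad_cont: "\<And>i. continuous_on (fst ` C) (grad (f i))"
    and U: "convex U" "zstar \<in> interior U"
    and stationary: "grad (Phi f \<tau>) zstar = 0"
    and m_M: "0 < m\<^sub>\<Phi>" "m\<^sub>\<Phi> \<le> M\<^sub>\<Phi>"
    and hess_exists: "\<And>w. w \<in> U \<Longrightarrow> grad (Phi f \<tau>) differentiable (at w)"
    and hess_lower: "\<And>w. w \<in> U \<Longrightarrow> loewner_le (\<lambda>v. m\<^sub>\<Phi> *\<^sub>R v) (hess (Phi f \<tau>) w)"
    and hess_upper: "\<And>w. w \<in> U \<Longrightarrow> loewner_le (hess (Phi f \<tau>) w) (\<lambda>v. M\<^sub>\<Phi> *\<^sub>R v)"
    and eventually_in_U: "\<forall>\<^sub>F l in sequentially. z l \<in> U \<and> trial_segments p (z l) (d l) (k l) \<subseteq> U"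
  shows "(\<forall>w. is_arg_min (Phi f \<tau>) (\<lambda>v. v \<in> U) w \<longleftrightarrow> w = zstar) \<and>
         (\<exists>q. 0 < q \<and> q < 1 \<and>
            (\<forall>\<^sub>F l in sequentially.
               Phi f \<tau> (z (Suc l)) - Phi f \<tau> zstar \<le> q * (Phi f \<tau> (z l) - Phi f \<tau> zstar))) \<and>
         (\<exists>C' \<rho>. 0 < \<rho> \<and> \<rho> < 1 \<and>
            (\<forall>\<^sub>F l in sequentially. norm (z l - zstar) \<le> C' * \<rho> ^ l))"
proof -
  let ?F = "Phi f \<tau>"
  let ?G = "grad ?F"
  have GD: "GDERIV ?F w :> ?G w" for w
    using differentiable_Phi[OF f_diff tau] by (rule GDERIV_grad)
  have HD: "(?G has_derivative hess ?F w) (at w)" if "w \<in> U" for w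
    using hess_exists[OF that] unfolding hess_def by (simp add: frechet_derivative_works)
  have zU: "zstar \<in> U" using U interior_subset by blast
  have lower: "?F a + ?G a \<bullet> (b - a) + m\<^sub>\<Phi> / 2 * (norm (b - a))\<^sup>2 \<le> ?F b" if "a \<in> U" "b \<in> U" for a b
    by (rule quadratic_lower_bound[OF U(1) that GD HD])
       (use hess_lower in \<open>auto simp: loewner_le_def inner_simps\<close>)
  have upper: "?F b \<le> ?F a + ?G a \<bullet> (b - a) + M\<^sub>\<Phi> / 2 * (norm (b - a))\<^sup>2" if "a \<in> U" "b \<in> U" for a b
    by (rule quadratic_upper_bound[OF U(1) that GD HD])
       (use hess_upper in \<open>auto simp: loewner_le_def inner_simps\<close>)
  have growth: "m\<^sub>\<Phi> / 2 * (norm (w - zstar))\<^sup>2 \<le> ?F w - ?F zstar" if "w \<in> U" for w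
    using lower[OF zU that] stationary by simp
  have gap: "0 \<le> ?F w - ?F zstar" if "w \<in> U" for w
    using growth[OF that] m_M by (meson order_trans mult_nonneg_nonneg zero_le_power2 less_imp_le half_gt_zero)
  \<comment> \<open>The Polyak-Lojasiewicz inequality: the quadratic lower model at
    \<open>w\<close>, evaluated at \<open>zstar\<close>, is bounded below by completing the
    square.\<close>
  have dominated: "2 * m\<^sub>\<Phi> * (?F w - ?F zstar) \<le> (norm (?G w))\<^sup>2" if "w \<in> U" for w
  proof -
    let ?u = "zstar - w"
    have "0 \<le> (norm (?G w + m\<^sub>\<Phi> *\<^sub>R ?u))\<^sup>2" by simp
    also have "\<dots> = (norm (?G w))\<^sup>2 + 2 * m\<^sub>\<Phi> * (?G w \<bullet> ?u + m\<^sub>\<Phi> / 2 * (norm ?u)\<^sup>2)"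
      unfolding power2_norm_eq_inner by (simp add: inner_add_left inner_add_right inner_commute algebra_simps)
    also have "\<dots> \<le> (norm (?G w))\<^sup>2 + 2 * m\<^sub>\<Phi> * (?F zstar - ?F w)"
      using lower[OF that zU] m_M by (intro add_left_mono mult_left_mono) auto
    finally show ?thesis by (simp add: algebra_simps)
  qed
  have unique: "is_arg_min ?F (\<lambda>v. v \<in> U) w \<longleftrightarrow> w = zstar" for w
  proof
    assume "is_arg_min ?F (\<lambda>v. v \<in> U) w"
    then have w: "w \<in> U" "?F w \<le> ?F zstar" using zU unfolding is_arg_min_def not_less[symmetric] by blast+
    then have "m\<^sub>\<Phi> / 2 * (norm (w - zstar))\<^sup>2 \<le> 0" using growth[OF w(1)] by simp
    then show "w = zstar" using m_M by (simp add: mult_le_0_iff)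
  next
    assume "w = zstar"
    then show "is_arg_min ?F (\<lambda>v. v \<in> U) w"
      using gap zU by (force simp: is_arg_min_def not_less)
  qed

  \<comment> \<open>Nonnegativity, inherent in being a Lipschitz constant, keeps the
    \<open>Pi_x\<close> term of the preconditioner positive semidefinite.\<close>
  have L: "0 \<le> L i" for i using lip lipschitz_on_nonneg by blast
  obtain c1 c2 where c: "0 < c1" "0 < c2"
    and desc: "\<And>l. ?G (z l) \<bullet> d l \<le> - c1 * (norm (?G (z l)))\<^sup>2"
    and dn: "\<And>l. norm (d l) \<le> c2 * norm (?G (z l))"
    using hmlbfgs_run_directions[OF params tau L run C(1,3) grad_cont] by blast
  have run': "?G (z l) \<noteq> 0" "backtracking p ?F (z l) (d l) (k l)"
    "z (Suc l) = z l + trial_step p (k l) *\<^sub>R d l" for l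
    using run unfolding hmlbfgs_run_def Let_def by blast+
  obtain N where N: "\<And>l. N \<le> l \<Longrightarrow> z l \<in> U" "\<And>l. N \<le> l \<Longrightarrow> trial_segments p (z l) (d l) (k l) \<subseteq> U"
    using eventually_in_U by (auto simp: eventually_sequentially)
  define \<kappa> where "\<kappa> = armijo_alpha p *
    min (step0 p) (back_beta p * (2 * (1 - armijo_alpha p) * c1 / (M\<^sub>\<Phi> * c2\<^sup>2))) * c1"
  have M: "0 < M\<^sub>\<Phi>" using m_M by simp
  have \<kappa>: "0 < \<kappa>" using params c M by (simp add: \<kappa>_def valid_params_def)
  \<comment> \<open>The natural factor could a priori be nonpositive; the maximum with 1/2 enforces
    \<open>0 < q\<close> and is harmless since the gap is nonnegative.\<close>
  define q where "q = max (1 / 2) (1 - 2 * m\<^sub>\<Phi> * \<kappa>)"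
  have q: "0 < q" "q < 1" using \<kappa> m_M by (auto simp: q_def)
  have contract: "?F (z (Suc l)) - ?F zstar \<le> q * (?F (z l) - ?F zstar)" if "N \<le> l" for l
  proof -
    have "?F (z (Suc l)) \<le> ?F (z l) - \<kappa> * (norm (?G (z l)))\<^sup>2"
      unfolding run'(3) \<kappa>_def
      using params M c upper[OF N(1)[OF that]] run'(2) N(2)[OF that] run'(1) desc dn
      by (rule backtracking_decrease)
    also have "\<dots> \<le> ?F (z l) - \<kappa> * (2 * m\<^sub>\<Phi> * (?F (z l) - ?F zstar))"
      using dominated[OF N(1)[OF that]] \<kappa> by (intro diff_left_mono mult_left_mono) auto
    finally have "?F (z (Suc l)) - ?F zstar \<le> (1 - 2 * m\<^sub>\<Phi> * \<kappa>) * (?F (z l) - ?F zstar)"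
      by (simp add: algebra_simps)
    also have "\<dots> \<le> q * (?F (z l) - ?F zstar)"
      using gap[OF N(1)[OF that]] by (intro mult_right_mono) (auto simp: q_def)
    finally show ?thesis .
  qed
  have geometric: "?F (z (N + j)) - ?F zstar \<le> q ^ j * (?F (z N) - ?F zstar)" for j
  proof (induction j)
    case (Suc j)
    have "?F (z (N + Suc j)) - ?F zstar \<le> q * (?F (z (N + j)) - ?F zstar)"
      using contract[of "N + j"] by simp
    also have "\<dots> \<le> q * (q ^ j * (?F (z N) - ?F zstar))"
      using Suc q by (intro mult_left_mono) auto
    finally show ?case by (simp add: mult.assoc)
  qed simp
  \<comment> \<open>The squared distance is at most 2 / \<open>m\<^sub>\<Phi>\<close> times the gap,
    so the distance decays at the square root of the rate of the gap.\<close>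
  define \<rho> where "\<rho> = sqrt q"
  have \<rho>: "0 < \<rho>" "\<rho> < 1" "\<rho>\<^sup>2 = q" using q by (auto simp: \<rho>_def)
  define K where "K = 2 / m\<^sub>\<Phi> * (?F (z N) - ?F zstar)"
  have K: "0 \<le> K" using gap[OF N(1)[of N]] m_M by (simp add: K_def)
  \<comment> \<open>Dividing by \<rho> ^ N converts the exponent counted from \<open>N\<close> into
    one counted from 0.\<close>
  have iterates: "norm (z l - zstar) \<le> sqrt K / \<rho> ^ N * \<rho> ^ l" if l: "N \<le> l" for l
  proof -
    obtain j where j: "l = N + j" using l le_Suc_ex by blast
    have "(norm (z l - zstar))\<^sup>2 = 2 / m\<^sub>\<Phi> * (m\<^sub>\<Phi> / 2 * (norm (z l - zstar))\<^sup>2)"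
      using m_M by simp
    also have "\<dots> \<le> 2 / m\<^sub>\<Phi> * (q ^ j * (?F (z N) - ?F zstar))"
      using growth[OF N(1)[OF l]] geometric[of j] m_M j by (intro mult_left_mono) auto
    also have "\<dots> = q ^ j * K" by (simp add: K_def)
    also have "\<dots> = (\<rho> ^ j * sqrt K)\<^sup>2"
      using K by (simp add: \<rho>(3)[symmetric] power_mult_distrib power_mult[symmetric] mult.commute)
    finally have "norm (z l - zstar) \<le> \<rho> ^ j * sqrt K"
      using \<rho> K by (intro power2_le_imp_le[of "norm (z l - zstar)"]) auto
    then show ?thesis using \<rho> by (simp add: j power_add mult.commute)
  qed
  have "\<forall>\<^sub>F l in sequentially. ?F (z (Suc l)) - ?F zstar \<le> q * (?F (z l) - ?F zstar)"
    using contract by (auto simp: eventually_sequentially)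
  moreover have "\<forall>\<^sub>F l in sequentially. norm (z l - zstar) \<le> sqrt K / \<rho> ^ N * \<rho> ^ l"
    using iterates by (auto simp: eventually_sequentially)
  ultimately show ?thesis using unique q \<rho> by blast
qed

end
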